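(* There exist absolute constants $c>0$ and $c'>0$ such that the following holds. Let $\varepsilon\in(0,1)$ be given, let $n$ be sufficiently large (depending on $\varepsilon$), and let $k$ be an integer with $1/\sqrt{\varepsilon}\le k\le c\sqrt{\varepsilon}\,n$. Then there exists an $n$-point metric space $\mathbb{X}$ such that every embedding of $\mathbb{X}$ in $\mathbb{R}^2$ has distortion at least $c'\sqrt{\varepsilon}\,n/k$, while every $k$-point subspace of $\mathbb{X}$ can be embedded in $\mathbb{R}^2$ with distortion at most $1+\varepsilon$.
   Context: $\mathbb{R}^2$ carries the Euclidean metric. For metric spaces $(X,\rho_X)$ and $(Y,\rho_Y)$ and an injective map (embedding) $f:X\to Y$, the distortion of $f$ is the smallest $D\ge 1$ such that there exists $\alpha>0$ with $\alpha\rho_X(x,y)\le\rho_Y(f(x),f(y))\le D\alpha\rho_X(x,y)$ for all $x,y\in X$. *)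

theory Defs
  imports "HOL-Analysis.Analysis"
begin

definition metric_embedding :: "'a metric \<Rightarrow> 'b metric \<Rightarrow> ('a \<Rightarrow> 'b) \<Rightarrow> bool" where
  "metric_embedding X Y f \<longleftrightarrow> f \<in> mspace X \<rightarrow> mspace Y \<and> inj_on f (mspace X)"

definition distortion_le :: "'a metric \<Rightarrow> 'b metric \<Rightarrow> ('a \<Rightarrow> 'b) \<Rightarrow> real \<Rightarrow> bool" where
  "distortion_le X Y f D \<longleftrightarrow> D \<ge> 1 \<and>
     (\<exists>\<alpha>>0. \<forall>x\<in>mspace X. \<forall>y\<in>mspace X.
        \<alpha> * mdist X x y \<le> mdist Y (f x) (f y) \<and>
        mdist Y (f x) (f y) \<le> D * \<alpha> * mdist X x y)"

text \<open>The least element exists whenever the domain is finite and \<open>f\<close> is an embedding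
  (see \<open>distortion_le_distortion\<close> below); for a map on an infinite space of infinite distortion
  the value is unspecified.\<close>

definition distortion :: "'a metric \<Rightarrow> 'b metric \<Rightarrow> ('a \<Rightarrow> 'b) \<Rightarrow> real" where
  "distortion X Y f = (LEAST D. distortion_le X Y f D)"

lemma distortion_minimum_exists:
  assumes fin: "finite (mspace X)" and emb: "metric_embedding X Y f"
  shows "\<exists>D. distortion_le X Y f D \<and> (\<forall>D'. distortion_le X Y f D' \<longrightarrow> D \<le> D')"
proof -
  define P where "P = {(x, y). x \<in> mspace X \<and> y \<in> mspace X \<and> x \<noteq> y}"
  define r where "r = (\<lambda>(x, y). mdist Y (f x) (f y) / mdist X x y)"
  have finP: "finite P"
    by (rule finite_subset[of _ "mspace X \<times> mspace X"]) (auto simp: P_def fin)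
  have dX: "mdist X x y > 0" if "(x, y) \<in> P" for x y
    using that by (auto simp: P_def intro!: Metric_space.mdist_pos_less[OF Metric_space_mspace_mdist])
  have fY: "f x \<in> mspace Y" if "x \<in> mspace X" for x
    using emb that by (auto simp: metric_embedding_def)
  have dY: "mdist Y (f x) (f y) > 0" if "(x, y) \<in> P" for x y
    using that emb fY
    by (auto simp: P_def metric_embedding_def inj_on_def
        intro!: Metric_space.mdist_pos_less[OF Metric_space_mspace_mdist])
  have zero: "mdist X x x = 0" "mdist Y (f x) (f x) = 0" if "x \<in> mspace X" for x
    by (rule Metric_space.mdist_zero[OF Metric_space_mspace_mdist], rule that)
      (rule Metric_space.mdist_zero[OF Metric_space_mspace_mdist], rule fY[OF that])
  show ?thesis
  proof (cases "P = {}")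
    case True
    then have eq: "x = y" if "x \<in> mspace X" "y \<in> mspace X" for x y
      using that by (auto simp: P_def)
    have "\<alpha> * mdist X x y \<le> mdist Y (f x) (f y) \<and> mdist Y (f x) (f y) \<le> 1 * \<alpha> * mdist X x y"
      if "x \<in> mspace X" "y \<in> mspace X" for x y \<alpha>
      using eq[OF that] that by (simp add: zero)
    from this[of _ _ 1] have "distortion_le X Y f 1"
      unfolding distortion_le_def by (meson order_refl zero_less_one)
    moreover have "1 \<le> D" if "distortion_le X Y f D" for D
      using that unfolding distortion_le_def by (rule conjunct1)
    ultimately show ?thesis by blast
  next
    case False
    define a where "a = Min (r ` P)"
    define b where "b = Max (r ` P)"
    have ar: "a \<le> r p" and rb: "r p \<le> b" if "p \<in> P" for p
      using that finP by (auto simp: a_def b_def)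
    have "a \<in> r ` P" and "b \<in> r ` P"
      using finP False by (auto simp: a_def b_def)
    then obtain x1 y1 x2 y2 where p1: "(x1, y1) \<in> P" "a = r (x1, y1)"
      and p2: "(x2, y2) \<in> P" "b = r (x2, y2)"
      by (metis imageE surj_pair)
    have a0: "a > 0" using p1 dX dY by (simp add: r_def)
    have ab: "a \<le> b" using ar[OF p2(1)] p2(2) by simp
    have main: "a * mdist X x y \<le> mdist Y (f x) (f y) \<and>
        mdist Y (f x) (f y) \<le> b / a * a * mdist X x y"
      if "x \<in> mspace X" "y \<in> mspace X" for x y
    proof (cases "x = y")
      case True
      then show ?thesis using that by (simp add: zero)
    next
      case False
      then have p: "(x, y) \<in> P" using that by (simp add: P_def)
      show ?thesis using ar[OF p] rb[OF p] dX[OF p] a0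
        by (simp add: r_def pos_le_divide_eq pos_divide_le_eq)
    qed
    have "distortion_le X Y f (b / a)"
      unfolding distortion_le_def
    proof (intro conjI exI[of _ a] ballI)
      show "1 \<le> b / a" using a0 ab by simp
    qed (use a0 main in blast)+
    moreover have "b / a \<le> D" if D: "distortion_le X Y f D" for D
    proof -
      from D obtain \<alpha> where \<alpha>: "\<alpha> > 0" "D \<ge> 1"
        and le: "\<And>x y. x \<in> mspace X \<Longrightarrow> y \<in> mspace X \<Longrightarrow> \<alpha> * mdist X x y \<le> mdist Y (f x) (f y) \<and>
          mdist Y (f x) (f y) \<le> D * \<alpha> * mdist X x y"
        unfolding distortion_le_def by blast
      have "\<alpha> \<le> a"
        using conjunct1[OF le[of x1 y1]] p1 dX[OF p1(1)] by (simp add: r_def P_def pos_le_divide_eq)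
      moreover have "b \<le> D * \<alpha>"
        using conjunct2[OF le[of x2 y2]] p2 dX[OF p2(1)] by (simp add: r_def P_def pos_divide_le_eq)
      moreover have "D * \<alpha> \<le> D * a" using \<open>\<alpha> \<le> a\<close> \<alpha> by simp
      ultimately show ?thesis using a0 by (simp add: pos_divide_le_eq)
    qed
    ultimately show ?thesis by blast
  qed
qed

lemma distortion_le_distortion:
  assumes "finite (mspace X)" and "metric_embedding X Y f"
  shows "distortion_le X Y f (distortion X Y f)"
proof -
  obtain D where D: "distortion_le X Y f D" "\<And>D'. distortion_le X Y f D' \<Longrightarrow> D \<le> D'"
    using distortion_minimum_exists[OF assms] by blast
  have "distortion X Y f = D"
    unfolding distortion_def by (rule Least_equality) (fact D)+
  then show ?thesis using D(1) by simp
qed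

lemma distortion_least:
  assumes "finite (mspace X)" and "metric_embedding X Y f" and "distortion_le X Y f D"
  shows "distortion X Y f \<le> D"
proof -
  obtain D0 where D0: "distortion_le X Y f D0" "\<And>D'. distortion_le X Y f D' \<Longrightarrow> D0 \<le> D'"
    using distortion_minimum_exists[OF assms(1,2)] by blast
  have "distortion X Y f = D0"
    unfolding distortion_def by (rule Least_equality) (fact D0)+
  then show ?thesis using D0(2)[OF assms(3)] by simp
qed

end

theory Submission
  imports Defs
begin

text \<open>
  Let the Moebius band consist of the points \<open>(z\<^sup>2, wz)\<close> of \<open>\<complex>\<^sup>2\<close> with \<open>\<bar>z\<bar> = 1\<close> and
  \<open>\<bar>w\<bar> \<le> h\<close>, where \<open>h\<close> is a small multiple of \<open>\<surd>\<epsilon> / k\<close>. Any \<open>k\<close> points of the band miss a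
  sector of angle of order \<open>1 / k\<close>. Cutting the band there fixes the sign of \<open>z\<close>, and
  \<open>(z\<^sup>2, wz) \<mapsto> (1 + w) z\<^sup>2\<close> then flattens the points into an annulus with distortion at most \<open>1 + \<epsilon>\<close>.

  The boundary of the band together with three rungs is a subdivision of the nonplanar graph
  \<open>K\<^sub>3\<^sub>,\<^sub>3\<close> whose disjoint edges have distance at least \<open>h\<close>. The \<open>n\<close>-point space contains a net of
  this graph with steps of order \<open>1 / n\<close>. If a map to the plane had distortion less than a
  multiple of \<open>hn\<close>, then along any two disjoint edges the steps of the image would be shorter than
  the distance of the image points, and the argument of their difference could be followed
  continuously. Comparing square roots of these differences attaches to every vertex and
  nonincident edge a sign; for two disjoint edges the product of the four signs is \<open>-1\<close>
  exactly if their endpoints interlace in the cyclic order of the vertices. Each sign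
  occurs for two pairs of edges, but three pairs (an odd number) interlace.
\<close>

section \<open>Discrete logarithms\<close>

text \<open>Discrete analogue of the increment of a continuous logarithm along a path avoiding 0:
  its imaginary part is the total turning of the argument when every step turns by less than
  pi.\<close>

definition log_sum :: "(nat \<Rightarrow> complex) \<Rightarrow> nat \<Rightarrow> complex" where
  "log_sum u m = (\<Sum>i<m. Ln (u (Suc i) / u i))"

lemma exp_log_sum:
  assumes "\<And>i. i \<le> m \<Longrightarrow> u i \<noteq> 0"
  shows "exp (log_sum u m) = u m / u 0"
  using assms
proof (induction m)
  case 0
  then show ?case by (simp add: log_sum_def)
next
  case (Suc m)
  then show ?case by (simp add: log_sum_def exp_add)
qed

lemma log_sum_uminus: "log_sum (\<lambda>i. - u i) m = log_sum u m"
  by (simp add: log_sum_def)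

lemma Re_divide_pos:
  assumes "norm (b - a) < norm (a :: complex)"
  shows "0 < Re (b / a)"
proof -
  have "norm (b / a - 1) < 1"
  proof -
    have "a \<noteq> 0" using assms by auto
    then have "b / a - 1 = (b - a) / a" by (simp add: field_simps)
    then show ?thesis using assms \<open>a \<noteq> 0\<close> by (simp add: norm_divide)
  qed
  then have "\<bar>Re (b / a - 1)\<bar> < 1"
    using abs_Re_le_cmod le_less_trans by blast
  then show ?thesis by simp
qed

text \<open>Both ratios lie in the right half plane, so their arguments add up to less than pi in
  modulus and no multiple of 2 pi has to be corrected.\<close>

lemma Ln_ratio_trans:
  fixes a b c :: complex
  assumes "norm (b - a) < norm a" "norm (c - b) < norm b"
  shows "Ln (b / a) + Ln (c / b) = Ln (c / a)"
proof -
  have pos: "0 < Re (b / a)" "0 < Re (c / b)"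
    using assms by (auto intro: Re_divide_pos)
  then have nz: "b / a \<noteq> 0" "c / b \<noteq> 0" by (metis less_irrefl zero_complex.sel(1))+
  have "\<bar>Im (Ln (b / a))\<bar> < pi / 2" "\<bar>Im (Ln (c / b))\<bar> < pi / 2"
    using Re_Ln_pos_lt[OF nz(1)] Re_Ln_pos_lt[OF nz(2)] pos by auto
  then have "Ln (b / a * (c / b)) = Ln (b / a) + Ln (c / b)"
    by (intro Ln_times_simple nz) auto
  then show ?thesis using nz by simp
qed

text \<open>Discrete homotopy invariance: the two monotone boundary paths of the grid turn equally.
  On a unit square both ways to the opposite corner give the logarithm of the diagonal ratio by
  \<open>Ln_ratio_trans\<close>; adding squares gives a row, adding rows the grid.\<close>

lemma log_sum_grid:
  fixes G :: "nat \<Rightarrow> nat \<Rightarrow> complex"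
  assumes "\<And>i j. i < m \<Longrightarrow> j \<le> l \<Longrightarrow> norm (G (Suc i) j - G i j) < norm (G i j)"
    and "\<And>i j. i \<le> m \<Longrightarrow> j < l \<Longrightarrow> norm (G i (Suc j) - G i j) < norm (G i j)"
  shows "log_sum (G 0) l + log_sum (\<lambda>i. G i l) m = log_sum (\<lambda>i. G i 0) m + log_sum (G m) l"
proof -
  have row: "log_sum (G i) l + Ln (G (Suc i) l / G i l) = Ln (G (Suc i) 0 / G i 0) + log_sum (G (Suc i)) l"
    if "i < m" for i
  proof -
    have "(\<Sum>j<j'. Ln (G i (Suc j) / G i j)) + Ln (G (Suc i) j' / G i j')
        = Ln (G (Suc i) 0 / G i 0) + (\<Sum>j<j'. Ln (G (Suc i) (Suc j) / G (Suc i) j))"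
      if "j' \<le> l" for j'
      using that
    proof (induction j')
      case (Suc j)
      have "Ln (G i (Suc j) / G i j) + Ln (G (Suc i) (Suc j) / G i (Suc j))
          = Ln (G (Suc i) j / G i j) + Ln (G (Suc i) (Suc j) / G (Suc i) j)"
        using Suc.prems \<open>i < m\<close> by (simp add: Ln_ratio_trans assms)
      moreover have "(\<Sum>j<j. Ln (G i (Suc j) / G i j)) + Ln (G (Suc i) j / G i j)
          = Ln (G (Suc i) 0 / G i 0) + (\<Sum>j<j. Ln (G (Suc i) (Suc j) / G (Suc i) j))"
        using Suc by simp
      ultimately show ?case unfolding sum.lessThan_Suc by algebra
    qed simp
    then show ?thesis by (simp add: log_sum_def)
  qed
  have "log_sum (G 0) l + log_sum (\<lambda>i. G i l) m' = log_sum (\<lambda>i. G i 0) m' + log_sum (G m') l"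
    if "m' \<le> m" for m'
    using that
  proof (induction m')
    case (Suc i)
    then show ?case using row[of i] by (simp add: log_sum_def algebra_simps)
  qed (simp add: log_sum_def)
  then show ?thesis by simp
qed

section \<open>The Moebius ladder in the plane\<close>

text \<open>The hexagon with its three long diagonals. Every edge joins an even to an odd vertex and
  all nine such pairs occur, so this is K_{3,3}; each pair is listed with the smaller endpoint
  first.\<close>

definition ladder_edges :: "(nat \<times> nat) set" where
  "ladder_edges = {(0,1), (1,2), (2,3), (3,4), (4,5), (0,5), (0,3), (1,4), (2,5)}"

definition disjoint_edges :: "nat \<times> nat \<Rightarrow> nat \<times> nat \<Rightarrow> bool" where
  "disjoint_edges e e' \<longleftrightarrow> {fst e, snd e} \<inter> {fst e', snd e'} = {}"

text \<open>
  \<open>edge_sign\<close> compares the root of \<open>(V v - V b) / (V v - V a)\<close> obtained by following the path from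
  \<open>a\<close> to \<open>b\<close> with the one obtained from roots of the differences \<open>V x - V y\<close> fixed in advance,
  whose choice satisfies \<open>vertex_root V y x = \<i> * vertex_root V x y\<close> for \<open>x < y\<close>.
\<close>

definition vertex_root :: "(nat \<Rightarrow> complex) \<Rightarrow> nat \<Rightarrow> nat \<Rightarrow> complex" where
  "vertex_root V x y = (if x < y then csqrt (V x - V y) else \<i> * csqrt (V y - V x))"

definition edge_sign ::
    "nat \<Rightarrow> (nat \<times> nat \<Rightarrow> nat \<Rightarrow> complex) \<Rightarrow> (nat \<Rightarrow> complex) \<Rightarrow> nat \<Rightarrow> nat \<Rightarrow> nat \<Rightarrow> complex" where
  "edge_sign m P V v a b =
    exp (log_sum (\<lambda>i. P (a, b) i - V v) m / 2) * vertex_root V v a / vertex_root V v b"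

text \<open>The differences of the points of the two paths form a grid to which
  \<open>log_sum_grid\<close> applies. Halving its logarithms gives a relation between the four
  followed roots, so these cancel in the product of the signs. What remains are quotients of
  \<open>vertex_root V x y\<close> and \<open>vertex_root V y x\<close>, which depend only on the
  order of the endpoints.\<close>

lemma edge_crossing_sign:
  fixes m :: nat and P :: "nat \<times> nat \<Rightarrow> nat \<Rightarrow> complex" and V :: "nat \<Rightarrow> complex"
  defines "\<sigma> \<equiv> edge_sign m P V"
  assumes ends: "P (a, b) 0 = V a" "P (a, b) m = V b" "P (c, d) 0 = V c" "P (c, d) m = V d"
    and step: "\<And>i j. i < m \<Longrightarrow> j \<le> m \<Longrightarrow>
        norm (P (a, b) (Suc i) - P (a, b) i) < norm (P (a, b) i - P (c, d) j)"
      "\<And>i j. i \<le> m \<Longrightarrow> j < m \<Longrightarrow>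
        norm (P (c, d) (Suc j) - P (c, d) j) < norm (P (a, b) i - P (c, d) j)"
    and m: "0 < m"
    and lt: "a < b" "c < d" "a \<noteq> c" "a \<noteq> d" "b \<noteq> c" "b \<noteq> d"
  shows "\<sigma> a c d * \<sigma> b c d * (\<sigma> c a b * \<sigma> d a b) =
      (if a < c \<and> c < b \<and> b < d \<or> c < a \<and> a < d \<and> d < b then -1 else 1)"
    and "\<sigma> a c d ^ 2 = 1" "\<sigma> b c d ^ 2 = 1" "\<sigma> c a b ^ 2 = 1" "\<sigma> d a b ^ 2 = 1"
proof -
  define r where "r = (\<lambda>v e. exp (log_sum (\<lambda>i. P e i - V v) m / 2))"
  define q where "q = vertex_root V"
  have \<sigma>_def: "\<sigma> v a b = r v (a, b) * q v a / q v b" for v a b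
    by (simp add: assms(1) edge_sign_def r_def q_def)
  define G where "G = (\<lambda>i j. P (a, b) i - P (c, d) j)"
  have nz: "P (a, b) i \<noteq> P (c, d) j" if "i \<le> m" "j \<le> m" for i j
  proof (cases "i < m")
    case True
    then show ?thesis using step(1)[OF True that(2)] by auto
  next
    case False
    show ?thesis
    proof (cases "j < m")
      case True
      then show ?thesis using step(2)[OF that(1) True] by auto
    next
      case f: False
      \<comment> \<open>No step starts at the last corner. If the two paths met there, the last step
        towards it would be exactly as long as the difference at its start.\<close>
      then show ?thesis using step(1)[of "m - 1" m] step(2)[of m "m - 1"] m False that
        by (cases m) (auto simp: norm_minus_commute)
    qed
  qed
  have Vnz: "V a \<noteq> V c" "V a \<noteq> V d" "V b \<noteq> V c" "V b \<noteq> V d"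
    using nz[of 0 0] nz[of 0 m] nz[of m 0] nz[of m m] ends by auto
  have rsq: "r v e ^ 2 = exp (log_sum (\<lambda>i. P e i - V v) m)" for v e
    by (simp add: r_def flip: exp_double)
  have qsq: "q x y ^ 2 = V x - V y" for x y
    by (simp add: q_def vertex_root_def power_mult_distrib)
  have q0: "q x y \<noteq> 0" if "V x \<noteq> V y" for x y
    using qsq[of x y] that by auto
  have q_swap: "q x y = (if x < y then - \<i> else \<i>) * q y x" if "x \<noteq> y" for x y
    using that by (auto simp: q_def vertex_root_def)
  have rsq': "r v (x, y) ^ 2 = (V v - V y) / (V v - V x)"
    if "P (x, y) 0 = V x" "P (x, y) m = V y" "\<And>i. i \<le> m \<Longrightarrow> P (x, y) i \<noteq> V v" for v x y
  proof -
    have "r v (x, y) ^ 2 = (V y - V v) / (V x - V v)"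
      unfolding rsq using that by (subst exp_log_sum) auto
    also have "\<dots> = (V v - V y) / (V v - V x)"
      by (metis minus_diff_eq minus_divide_divide)
    finally show ?thesis .
  qed
  have r2: "r a (c, d) ^ 2 = (V a - V d) / (V a - V c)" "r b (c, d) ^ 2 = (V b - V d) / (V b - V c)"
    using nz[of 0] nz[of m] ends by (intro rsq'; metis order_refl le0)+
  have r2': "r c (a, b) ^ 2 = (V c - V b) / (V c - V a)" "r d (a, b) ^ 2 = (V d - V b) / (V d - V a)"
    using nz[of _ 0] nz[of _ m] ends by (intro rsq'; metis order_refl le0)+
  show "\<sigma> a c d ^ 2 = 1" "\<sigma> b c d ^ 2 = 1" "\<sigma> c a b ^ 2 = 1" "\<sigma> d a b ^ 2 = 1"
    using Vnz by (simp_all add: \<sigma>_def power_mult_distrib power_divide qsq r2 r2')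
  \<comment> \<open>A sign is its own inverse. Inverting two of the four puts the followed roots
    into the quotient that the grid identity shows to be 1.\<close>
  then have inv: "\<sigma> b c d = 1 / \<sigma> b c d" "\<sigma> c a b = 1 / \<sigma> c a b"
    by (auto simp: power2_eq_1_iff)
  \<comment> \<open>Both sides go from the pair of starting points (a, c) to the pair of end points
    (b, d), moving the two points in opposite orders.\<close>
  have "log_sum (G 0) m + log_sum (\<lambda>i. G i m) m = log_sum (\<lambda>i. G i 0) m + log_sum (G m) m"
    by (rule log_sum_grid) (use step in \<open>auto simp: G_def norm_minus_commute\<close>)
  moreover have "log_sum (\<lambda>j. P (c, d) j - V v) m = log_sum (\<lambda>j. V v - P (c, d) j) m" for v
    using log_sum_uminus[of "\<lambda>j. P (c, d) j - V v" m] by simp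
  ultimately have "r a (c, d) * r d (a, b) = r c (a, b) * r b (c, d)"
    unfolding r_def
    by (simp add: G_def ends flip: exp_add add_divide_distrib)
  moreover have "r c (a, b) \<noteq> 0" "r b (c, d) \<noteq> 0" by (simp_all add: r_def)
  ultimately have "\<sigma> a c d * (1 / \<sigma> b c d) * ((1 / \<sigma> c a b) * \<sigma> d a b)
      = (q a c / q c a) * (q d a / q a d) * (q b d / q d b) * (q c b / q b c)"
    using Vnz q0 by (simp add: \<sigma>_def divide_simps)
  also have "q a c / q c a = (if a < c then -\<i> else \<i>)" using lt q0[of c a] q_swap[of a c] Vnz by simp
  also have "q d a / q a d = (if d < a then -\<i> else \<i>)" using lt q0[of a d] q_swap[of d a] Vnz by simp
  also have "q b d / q d b = (if b < d then -\<i> else \<i>)" using lt q0[of d b] q_swap[of b d] Vnz by simp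
  also have "q c b / q b c = (if c < b then -\<i> else \<i>)" using lt q0[of b c] q_swap[of c b] Vnz by simp
  finally show "\<sigma> a c d * \<sigma> b c d * (\<sigma> c a b * \<sigma> d a b) =
      (if a < c \<and> c < b \<and> b < d \<or> c < a \<and> a < d \<and> d < b then -1 else 1)"
    unfolding inv[symmetric] using lt by (auto split: if_splits)
qed

text \<open>A discrete nonplanarity of K_{3,3} in the Hanani-Tutte sense: only disjoint edges count,
  whatever adjacent ones do. If the conclusion fails, the hypotheses of
  \<open>edge_crossing_sign\<close> hold for every disjoint pair, since the two edges may be
  swapped, and the parities of the signs contradict each other.\<close>

lemma disjoint_ladder_edges_meet:
  fixes P :: "nat \<times> nat \<Rightarrow> nat \<Rightarrow> complex" and V :: "nat \<Rightarrow> complex"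
  assumes "0 < m"
    and ends: "\<And>a b. (a, b) \<in> ladder_edges \<Longrightarrow> P (a, b) 0 = V a \<and> P (a, b) m = V b"
  shows "\<exists>e\<in>ladder_edges. \<exists>e'\<in>ladder_edges. disjoint_edges e e' \<and>
    (\<exists>i<m. \<exists>j\<le>m. norm (P e i - P e' j) \<le> norm (P e (Suc i) - P e i))"
proof (rule ccontr)
  assume "\<not> ?thesis"
  then have step: "norm (P e (Suc i) - P e i) < norm (P e i - P e' j)"
    if "e \<in> ladder_edges" "e' \<in> ladder_edges" "disjoint_edges e e'" "i < m" "j \<le> m" for e e' i j
    using that by (meson not_less)
  define \<sigma> where "\<sigma> = edge_sign m P V"
  define T where "T = (\<lambda>a b c d. \<sigma> a c d * \<sigma> b c d)"
  have lt: "a < b" if "(a, b) \<in> ladder_edges" for a b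
    using that by (auto simp: ladder_edges_def)
  have disj: "disjoint_edges (a, b) (c, d) \<longleftrightarrow> a \<noteq> c \<and> a \<noteq> d \<and> b \<noteq> c \<and> b \<noteq> d" for a b c d
    by (auto simp: disjoint_edges_def)
  have cross: "T a b c d * T c d a b =
        (if a < c \<and> c < b \<and> b < d \<or> c < a \<and> a < d \<and> d < b then -1 else 1)"
    and sq: "\<sigma> a c d ^ 2 = 1" "\<sigma> b c d ^ 2 = 1"
    if e: "(a, b) \<in> ladder_edges" "(c, d) \<in> ladder_edges" and "disjoint_edges (a, b) (c, d)" for a b c d
  proof -
    have d': "disjoint_edges (c, d) (a, b)" using that(3) by (auto simp: disj)
    have step': "norm (P (c, d) (Suc j) - P (c, d) j) < norm (P (a, b) i - P (c, d) j)"
      if "i \<le> m" "j < m" for i j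
      using step[OF e(2) e(1) d' that(2,1)] by (simp add: norm_minus_commute)
    note * = edge_crossing_sign[where P = P and V = V and m = m, OF _ _ _ _ step[OF e that(3)] step' \<open>0 < m\<close>
      lt[OF e(1)] lt[OF e(2)]]
    show "T a b c d * T c d a b =
        (if a < c \<and> c < b \<and> b < d \<or> c < a \<and> a < d \<and> d < b then -1 else 1)" "\<sigma> a c d ^ 2 = 1" "\<sigma> b c d ^ 2 = 1"
      unfolding T_def \<sigma>_def using ends[OF e(1)] ends[OF e(2)] that(3) *(1-3) by (auto simp: disj)
  qed
  \<comment> \<open>the edges disjoint from a given one form a cycle of length 4, so each sign occurs twice\<close>
  have cycle: "T x y c d * T z w c d * T x' y' c d * T z' w' c d = 1"
    if "(c, d) \<in> ladder_edges" "(x, y) \<in> ladder_edges" "(z, w) \<in> ladder_edges"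
      "disjoint_edges (x, y) (c, d)" "disjoint_edges (z, w) (c, d)"
      "{#x', y', z', w'#} = {#x, y, z, w#}" for c d x y z w x' y' z' w'
  proof -
    have "(\<Prod>v\<in>#{#x', y', z', w'#}. \<sigma> v c d) = (\<Prod>v\<in>#{#x, y, z, w#}. \<sigma> v c d)"
      by (simp only: that(6))
    then show ?thesis
      using sq[OF that(2,1,4)] sq[OF that(3,1,5)] unfolding T_def
      by (simp only: image_mset_add_mset prod_mset.add_mset image_mset_empty prod_mset_empty) algebra
  qed
  have cycles: "T 2 3 0 1 * T 4 5 0 1 * T 3 4 0 1 * T 2 5 0 1 = 1"
    "T 3 4 1 2 * T 0 5 1 2 * T 4 5 1 2 * T 0 3 1 2 = 1"
    "T 0 1 2 3 * T 4 5 2 3 * T 0 5 2 3 * T 1 4 2 3 = 1"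
    "T 0 1 3 4 * T 2 5 3 4 * T 1 2 3 4 * T 0 5 3 4 = 1"
    "T 0 1 4 5 * T 2 3 4 5 * T 1 2 4 5 * T 0 3 4 5 = 1"
    "T 1 2 0 5 * T 3 4 0 5 * T 2 3 0 5 * T 1 4 0 5 = 1"
    "T 1 2 0 3 * T 4 5 0 3 * T 1 4 0 3 * T 2 5 0 3 = 1"
    "T 2 3 1 4 * T 0 5 1 4 * T 0 3 1 4 * T 2 5 1 4 = 1"
    "T 0 1 2 5 * T 3 4 2 5 * T 0 3 2 5 * T 1 4 2 5 = 1"
    by (rule cycle; simp add: ladder_edges_def disj)+
  have crossings: "T 0 1 2 3 * T 2 3 0 1 = 1"
    "T 0 1 3 4 * T 3 4 0 1 = 1"
    "T 0 1 4 5 * T 4 5 0 1 = 1"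
    "T 0 1 2 5 * T 2 5 0 1 = 1"
    "T 1 2 3 4 * T 3 4 1 2 = 1"
    "T 1 2 4 5 * T 4 5 1 2 = 1"
    "T 1 2 0 5 * T 0 5 1 2 = 1"
    "T 1 2 0 3 * T 0 3 1 2 = 1"
    "T 2 3 4 5 * T 4 5 2 3 = 1"
    "T 2 3 0 5 * T 0 5 2 3 = 1"
    "T 2 3 1 4 * T 1 4 2 3 = 1"
    "T 3 4 0 5 * T 0 5 3 4 = 1"
    "T 3 4 2 5 * T 2 5 3 4 = 1"
    "T 4 5 0 3 * T 0 3 4 5 = 1"
    "T 0 5 1 4 * T 1 4 0 5 = 1"
    "T 0 3 1 4 * T 1 4 0 3 = -1"
    "T 0 3 2 5 * T 2 5 0 3 = -1"
    "T 1 4 2 5 * T 2 5 1 4 = -1"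
    by (subst cross; simp add: ladder_edges_def disj)+
  \<comment> \<open>The same 36 factors grouped twice: by the edge whose signs they contain, giving
    1, and by the 18 disjoint pairs, giving -1 from the three pairs of rungs.\<close>
  have "(T 2 3 0 1 * T 4 5 0 1 * T 3 4 0 1 * T 2 5 0 1) *
      (T 3 4 1 2 * T 0 5 1 2 * T 4 5 1 2 * T 0 3 1 2) *
      (T 0 1 2 3 * T 4 5 2 3 * T 0 5 2 3 * T 1 4 2 3) *
      (T 0 1 3 4 * T 2 5 3 4 * T 1 2 3 4 * T 0 5 3 4) *
      (T 0 1 4 5 * T 2 3 4 5 * T 1 2 4 5 * T 0 3 4 5) *
      (T 1 2 0 5 * T 3 4 0 5 * T 2 3 0 5 * T 1 4 0 5) *
      (T 1 2 0 3 * T 4 5 0 3 * T 1 4 0 3 * T 2 5 0 3) *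
      (T 2 3 1 4 * T 0 5 1 4 * T 0 3 1 4 * T 2 5 1 4) *
      (T 0 1 2 5 * T 3 4 2 5 * T 0 3 2 5 * T 1 4 2 5)
    = (T 0 1 2 3 * T 2 3 0 1) *
      (T 0 1 3 4 * T 3 4 0 1) *
      (T 0 1 4 5 * T 4 5 0 1) *
      (T 0 1 2 5 * T 2 5 0 1) *
      (T 1 2 3 4 * T 3 4 1 2) *
      (T 1 2 4 5 * T 4 5 1 2) *
      (T 1 2 0 5 * T 0 5 1 2) *
      (T 1 2 0 3 * T 0 3 1 2) *
      (T 2 3 4 5 * T 4 5 2 3) *
      (T 2 3 0 5 * T 0 5 2 3) *
      (T 2 3 1 4 * T 1 4 2 3) *
      (T 3 4 0 5 * T 0 5 3 4) *
      (T 3 4 2 5 * T 2 5 3 4) *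
      (T 4 5 0 3 * T 0 3 4 5) *
      (T 0 5 1 4 * T 1 4 0 5) *
      (T 0 3 1 4 * T 1 4 0 3) *
      (T 0 3 2 5 * T 2 5 0 3) *
      (T 1 4 2 5 * T 2 5 1 4)"
    by (simp only: mult_ac)
  then show False
    unfolding cycles crossings by simp
qed

section \<open>The Moebius band\<close>

text \<open>Law of cosines: both sides equal a^2 + b^2 - 2ab Re (z * cnj u). It serves both the
  second coordinate of the band and the annulus, so the two squared distances can be compared term
  by term.\<close>

lemma norm_diff_unit_sq:
  fixes z u :: complex and a b :: real
  assumes "norm z = 1" "norm u = 1"
  shows "norm (of_real a * z - of_real b * u) ^ 2 = (a - b) ^ 2 + a * b * norm (z - u) ^ 2"
proof -
  have "Re z ^ 2 + Im z ^ 2 = 1" "Re u ^ 2 + Im u ^ 2 = 1"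
    using assms by (metis cmod_power2 one_power2)+
  then show ?thesis
    unfolding cmod_power2 by simp algebra
qed

text \<open>Note that \<open>band_point (- z) (- w) = band_point z w\<close>.\<close>

definition band_point :: "complex \<Rightarrow> real \<Rightarrow> complex \<times> complex" where
  "band_point z w = (z ^ 2, of_real w * z)"

definition moebius_band :: "real \<Rightarrow> (complex \<times> complex) set" where
  "moebius_band h = {band_point z w | z w. norm z = 1 \<and> \<bar>w\<bar> \<le> h}"

lemma dist_band_point_sq:
  assumes "norm z = 1" "norm u = 1"
  shows "dist (band_point z w) (band_point u v) ^ 2
    = norm (z ^ 2 - u ^ 2) ^ 2 + (w - v) ^ 2 + w * v * norm (z - u) ^ 2"
  using norm_diff_unit_sq[OF assms, of w v, symmetric]
  by (simp add: band_point_def dist_prod_def dist_norm real_sqrt_pow2 flip: add.assoc)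

section \<open>Cutting the band and flattening it into an annulus\<close>

lemma exists_cut_direction:
  fixes Z :: "complex set"
  assumes "finite Z" "card Z \<le> k" "0 < k" "\<And>z. z \<in> Z \<Longrightarrow> norm z = 1"
  shows "\<exists>q. norm q = 1 \<and> (\<forall>z\<in>Z. 1 / (8 * real k) \<le> \<bar>Re (z * cnj q)\<bar>)"
proof (rule ccontr)
  assume neg: "\<nexists>q. norm q = 1 \<and> (\<forall>z\<in>Z. 1 / (8 * real k) \<le> \<bar>Re (z * cnj q)\<bar>)"
  \<comment> \<open>Otherwise each of \<open>k + 1\<close> well separated directions is almost orthogonal to some point of \<open>Z\<close>,
     but no point is almost orthogonal to two of them.\<close>
  define p where "p = (\<lambda>j::nat. Complex 1 (real j / real k))"
  have p_nz: "norm (p j) \<noteq> 0" for j by (simp add: p_def complex_eq_iff)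
  have "\<exists>z\<in>Z. \<bar>Re (z * cnj (p j / of_real (norm (p j))))\<bar> < 1 / (8 * real k)" for j
  proof -
    have "norm (p j / of_real (norm (p j))) = 1" using p_nz[of j] by (simp add: norm_divide)
    with neg show ?thesis by (meson not_le)
  qed
  then obtain f where f: "\<And>j. f j \<in> Z"
    and f_less: "\<And>j. \<bar>Re (f j * cnj (p j / of_real (norm (p j))))\<bar> < 1 / (8 * real k)"
    by metis
  have f_small: "\<bar>Re (f j * cnj (p j))\<bar> < 1 / (4 * real k)" if "j \<le> k" for j
  proof -
    have "real j / real k \<le> 1" "0 \<le> real j / real k" using that \<open>0 < k\<close> by auto
    then have "norm (p j) ^ 2 \<le> 2 ^ 2"
      unfolding cmod_power2 p_def using power_mono[of "real j / real k" 1 2] by simp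
    then have le: "norm (p j) \<le> 2" by (rule power2_le_imp_le) simp
    have "Re (f j * cnj (p j / of_real (norm (p j)))) = Re (f j * cnj (p j)) / norm (p j)"
      by (simp add: add_divide_distrib)
    then have "\<bar>Re (f j * cnj (p j))\<bar> < norm (p j) * (1 / (8 * real k))"
      using f_less[of j] p_nz[of j] by (simp add: abs_divide pos_divide_less_eq mult_ac)
    also have "\<dots> \<le> 2 * (1 / (8 * real k))" by (intro mult_right_mono le) simp
    finally show ?thesis by simp
  qed
  have "card (f ` {..k}) \<le> k"
    using card_mono[of Z "f ` {..k}"] f assms by fastforce
  then have "\<not> inj_on f {..k}" by (metis card_atMost card_image not_less_eq_eq order_refl)
  then obtain i j where ij: "i \<le> k" "j \<le> k" "i < j" "f i = f j"
    by (metis atMost_iff inj_on_def linorder_neqE_nat)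
  define z where "z = f i"
  have "norm z = 1" using f assms(4) by (simp add: z_def)
  have re: "Re (z * cnj (p l)) = Re z + Im z * (real l / real k)" for l by (simp add: p_def)
  define s t where "s = real i / real k" and "t = real j / real k"
  have st: "0 \<le> s" "s < t" "t \<le> 1" "1 / real k \<le> t - s"
    using ij assms(3) by (auto simp: s_def t_def divide_simps)
  \<comment> \<open>If one point serves two slopes s < t, both affine expressions are small.
    Eliminating Re z or Im z bounds each of them by 1/2, too small for a unit vector.\<close>
  define A B where "A = Re z + Im z * s" and "B = Re z + Im z * t"
  have AB: "\<bar>A\<bar> < 1 / (4 * real k)" "\<bar>B\<bar> < 1 / (4 * real k)"
    using f_small[OF ij(1)] f_small[OF ij(2)]
    by (simp_all only: A_def B_def ij(4)[symmetric] z_def[symmetric] re s_def t_def)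
  have Im_le: "\<bar>Im z\<bar> * (t - s) < 1 / (2 * real k)"
  proof -
    have "\<bar>B - A\<bar> < 1 / (2 * real k)" using AB by (simp add: abs_less_iff)
    moreover have "B - A = Im z * (t - s)" by (simp add: A_def B_def algebra_simps)
    ultimately show ?thesis using st by (simp add: abs_mult)
  qed
  have Re_le: "\<bar>Re z\<bar> * (t - s) < 1 / (2 * real k)"
  proof -
    have "Re z * (t - s) = A * t - B * s" by (simp add: A_def B_def algebra_simps)
    moreover have "\<bar>A * t\<bar> \<le> \<bar>A\<bar>" "\<bar>B * s\<bar> \<le> \<bar>B\<bar>"
      using st mult_left_mono[of t 1 "\<bar>A\<bar>"] mult_left_mono[of s 1 "\<bar>B\<bar>"]
      by (auto simp: abs_mult)
    ultimately have "\<bar>Re z * (t - s)\<bar> < 1 / (2 * real k)" using AB by simp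
    then show ?thesis using st by (simp add: abs_mult)
  qed
  have half: "x < 1 / 2" if "x * (t - s) < 1 / (2 * real k)" "0 \<le> x" for x
  proof -
    have "x * (1 / real k) \<le> x * (t - s)" using st that by (intro mult_left_mono)
    then show ?thesis using that \<open>0 < k\<close> by (simp add: field_simps)
  qed
  have "\<bar>Re z\<bar> ^ 2 \<le> (1 / 2) ^ 2" "\<bar>Im z\<bar> ^ 2 \<le> (1 / 2) ^ 2"
    using half[OF Re_le] half[OF Im_le] by (intro power_mono; simp)+
  then have "norm z ^ 2 \<le> 1 / 2" unfolding cmod_power2 by (simp add: power_divide)
  then show False using \<open>norm z = 1\<close> by simp
qed


text \<open>Here Q + X + e is a squared distance in the band and X + t * Q the one after flattening:
  Q comes from the squares of the directions, X from the widths, e is the mixed term and t the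
  product of the two radii. The factor 1 - \<epsilon> / 3 becomes the square of the scaling constant
  and leaves room for the errors \<epsilon> / 4 in t and \<epsilon> / 64 in e.\<close>

lemma annulus_ratio_bounds:
  fixes X Q t e \<epsilon> :: real
  assumes "0 < \<epsilon>" "\<epsilon> < 1" "0 \<le> X" "0 \<le> Q" "\<bar>e\<bar> \<le> \<epsilon> / 64 * Q"
    and "1 - \<epsilon> / 4 \<le> t" "t \<le> 1 + 3 * \<epsilon> / 8"
  shows "(1 - \<epsilon> / 3) * (Q + X + e) \<le> X + t * Q"
    and "X + t * Q \<le> (1 + \<epsilon>) ^ 2 * (1 - \<epsilon> / 3) * (Q + X + e)"
proof -
  have tQ: "(1 - \<epsilon> / 4) * Q \<le> t * Q" "t * Q \<le> (1 + 3 * \<epsilon> / 8) * Q"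
    using assms by (intro mult_right_mono; simp)+
  have \<epsilon>Q: "0 \<le> \<epsilon> * Q" "0 \<le> \<epsilon> * X" "\<epsilon> * Q \<le> 1 * Q"
    using assms by (simp_all add: mult_left_le_one_le)
  have "(1 - \<epsilon> / 3) * e \<le> 1 * (\<epsilon> / 64 * Q)"
    using assms by (intro order_trans[OF mult_left_mono[of e "\<epsilon> / 64 * Q"]] mult_right_mono) auto
  moreover have "(1 - \<epsilon> / 3) * (Q + X + e) = Q + X - \<epsilon> * Q / 3 - \<epsilon> * X / 3 + (1 - \<epsilon> / 3) * e"
    "(1 - \<epsilon> / 4) * Q = Q - \<epsilon> * Q / 4"
    by (simp_all add: algebra_simps)
  ultimately show "(1 - \<epsilon> / 3) * (Q + X + e) \<le> X + t * Q"
    using tQ \<epsilon>Q by linarith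
  \<comment> \<open>This smaller factor, linear in \<epsilon>, already absorbs the errors 3 *
    \<epsilon> / 8 and 3 * \<epsilon> / 128.\<close>
  have "(1 + \<epsilon> / 2) * 1 \<le> (1 + \<epsilon>) ^ 2 * (1 - \<epsilon> / 3)"
  proof -
    have "\<epsilon> * \<epsilon> * \<epsilon> \<le> \<epsilon> * \<epsilon>"
      using mult_left_mono[of \<epsilon> 1 "\<epsilon> * \<epsilon>"] assms by simp
    moreover have "(1 + \<epsilon>) ^ 2 * (1 - \<epsilon> / 3) = 1 + 5 * \<epsilon> / 3 + \<epsilon> * \<epsilon> / 3 - \<epsilon> * \<epsilon> * \<epsilon> / 3"
      by (simp add: power2_eq_square algebra_simps)
    moreover have "0 \<le> \<epsilon> * \<epsilon>" by simp
    ultimately have "1 + \<epsilon> / 2 \<le> 1 + 5 * \<epsilon> / 3 + \<epsilon> * \<epsilon> / 3 - \<epsilon> * \<epsilon> * \<epsilon> / 3"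
      using assms(1) by linarith
    then show ?thesis by (simp add: power2_eq_square algebra_simps)
  qed
  then have "(1 + \<epsilon> / 2) * (Q + X + e) \<le> (1 + \<epsilon>) ^ 2 * (1 - \<epsilon> / 3) * (Q + X + e)"
    using assms \<epsilon>Q by (intro mult_right_mono) auto
  moreover have "(1 + \<epsilon> / 2) * - e \<le> 3 / 2 * (\<epsilon> / 64 * Q)"
    using assms by (intro order_trans[OF mult_left_mono[of "- e" "\<epsilon> / 64 * Q"]] mult_right_mono) auto
  moreover have "(1 + \<epsilon> / 2) * (Q + X + e) = Q + X + \<epsilon> * Q / 2 + \<epsilon> * X / 2 - (1 + \<epsilon> / 2) * - e"
    "(1 + 3 * \<epsilon> / 8) * Q = Q + 3 * (\<epsilon> * Q) / 8"
    by (simp_all add: algebra_simps)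
  ultimately show "X + t * Q \<le> (1 + \<epsilon>) ^ 2 * (1 - \<epsilon> / 3) * (Q + X + e)"
    using tQ \<epsilon>Q by linarith
qed

text \<open>The annulus reproduces the squared distance except for the radii and the mixed term w *
  w' * |z - z'|^2. The bound \<epsilon> / 16 on h controls the radii. After the cut, |z + z'| is at
  least 1 / (4k), so |z - z'|^2 is at most 16 k^2 |z^2 - z'^2|^2; the other bound on h then makes
  the mixed term at most \<epsilon> / 64 times |z^2 - z'^2|^2.\<close>

lemma moebius_band_finite_subset_planar:
  assumes S: "finite S" "S \<subseteq> moebius_band h" "card S \<le> k" and k: "0 < k"
    and \<epsilon>: "0 < \<epsilon>" "\<epsilon> < 1" and h: "0 \<le> h" "h \<le> sqrt \<epsilon> / (32 * real k)" "h \<le> \<epsilon> / 16"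
  shows "\<exists>G :: complex \<times> complex \<Rightarrow> complex. \<exists>\<alpha>>0. \<forall>p\<in>S. \<forall>p'\<in>S.
    \<alpha> * dist p p' \<le> dist (G p) (G p') \<and> dist (G p) (G p') \<le> (1 + \<epsilon>) * \<alpha> * dist p p'"
proof -
  have "\<forall>p\<in>S. \<exists>z w. norm z = 1 \<and> \<bar>w\<bar> \<le> h \<and> p = band_point z w"
    using S(2) unfolding moebius_band_def by blast
  then obtain z\<^sub>0 w\<^sub>0 where zw\<^sub>0: "\<And>p. p \<in> S \<Longrightarrow> norm (z\<^sub>0 p) = 1 \<and> \<bar>w\<^sub>0 p\<bar> \<le> h \<and> p = band_point (z\<^sub>0 p) (w\<^sub>0 p)"
    by metis
  \<comment> \<open>The line orthogonal to \<open>q\<close> is the cut. All points avoid it with a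
    margin, so taking the representative on the positive side fixes the sign of z.\<close>
  obtain q where q: "norm q = 1" and cut: "\<And>p. p \<in> S \<Longrightarrow> 1 / (8 * real k) \<le> \<bar>Re (z\<^sub>0 p * cnj q)\<bar>"
    using exists_cut_direction[of "z\<^sub>0 ` S" k] S(1,3) card_image_le[OF S(1), of z\<^sub>0] zw\<^sub>0 k by force
  have "\<exists>z w. norm z = 1 \<and> \<bar>w\<bar> \<le> h \<and> p = band_point z w \<and> 1 / (8 * real k) \<le> Re (z * cnj q)"
    if "p \<in> S" for p
  proof (cases "0 \<le> Re (z\<^sub>0 p * cnj q)")
    case True
    then show ?thesis using zw\<^sub>0[OF that] cut[OF that] by (intro exI[of _ "z\<^sub>0 p"] exI[of _ "w\<^sub>0 p"]) auto
  next
    case False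
    moreover have "band_point (- z\<^sub>0 p) (- w\<^sub>0 p) = p"
      using zw\<^sub>0[OF that] by (simp add: band_point_def)
    ultimately show ?thesis
      using zw\<^sub>0[OF that] cut[OF that] by (intro exI[of _ "- z\<^sub>0 p"] exI[of _ "- w\<^sub>0 p"]) auto
  qed
  then obtain z w where zw: "\<And>p. p \<in> S \<Longrightarrow> norm (z p) = 1" "\<And>p. p \<in> S \<Longrightarrow> \<bar>w p\<bar> \<le> h"
    "\<And>p. p \<in> S \<Longrightarrow> p = band_point (z p) (w p)" "\<And>p. p \<in> S \<Longrightarrow> 1 / (8 * real k) \<le> Re (z p * cnj q)"
    by metis
  define G where "G = (\<lambda>p. of_real (1 + w p) * z p ^ 2)"
  have bounds: "(1 - \<epsilon> / 3) * dist p p' ^ 2 \<le> dist (G p) (G p') ^ 2 \<and>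
      dist (G p) (G p') ^ 2 \<le> (1 + \<epsilon>) ^ 2 * (1 - \<epsilon> / 3) * dist p p' ^ 2"
    if p: "p \<in> S" "p' \<in> S" for p p'
  proof -
    define Q where "Q = norm (z p ^ 2 - z p' ^ 2) ^ 2"
    define X where "X = (w p - w p') ^ 2"
    define e where "e = w p * w p' * norm (z p - z p') ^ 2"
    define t where "t = (1 + w p) * (1 + w p')"
    have d: "dist p p' ^ 2 = Q + X + e"
      using dist_band_point_sq[of "z p" "z p'" "w p" "w p'"] zw(1,3) p
      by (metis Q_def X_def e_def)
    have "dist (G p) (G p') ^ 2 = norm (of_real (1 + w p) * z p ^ 2 - of_real (1 + w p') * z p' ^ 2) ^ 2"
      by (simp add: G_def dist_norm)
    also have "\<dots> = ((1 + w p) - (1 + w p')) ^ 2 + (1 + w p) * (1 + w p') * norm (z p ^ 2 - z p' ^ 2) ^ 2"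
      by (rule norm_diff_unit_sq) (simp_all add: zw(1) p norm_power)
    finally have dG: "dist (G p) (G p') ^ 2 = X + t * Q" by (simp add: X_def t_def Q_def)
    have "1 / (8 * real k) + 1 / (8 * real k) \<le> Re ((z p + z p') * cnj q)"
      using zw(4)[OF p(1)] zw(4)[OF p(2)] by (simp add: algebra_simps)
    also have "\<dots> \<le> norm (z p + z p')"
      using complex_Re_le_cmod[of "(z p + z p') * cnj q"] q by (simp add: norm_mult)
    finally have "1 / (4 * real k) \<le> norm (z p + z p')" by simp
    then have "(1 / (4 * real k)) ^ 2 \<le> norm (z p + z p') ^ 2"
      by (intro power_mono) simp_all
    then have "norm (z p - z p') ^ 2 * (1 / (4 * real k)) ^ 2 \<le> norm (z p - z p') ^ 2 * norm (z p + z p') ^ 2"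
      by (intro mult_left_mono) simp_all
    also have "\<dots> = Q"
      unfolding Q_def power_mult_distrib[symmetric] norm_mult[symmetric]
      by (simp add: power2_eq_square algebra_simps)
    finally have zQ: "norm (z p - z p') ^ 2 \<le> 16 * real k ^ 2 * Q"
      using k by (simp add: power_divide power_mult_distrib divide_le_eq mult_ac)
    have "h ^ 2 \<le> (sqrt \<epsilon> / (32 * real k)) ^ 2" using h by (intro power_mono)
    then have h2: "h ^ 2 \<le> \<epsilon> / (1024 * real k ^ 2)"
      using \<epsilon> by (simp add: power_divide power_mult_distrib)
    have "\<bar>w p * w p'\<bar> \<le> h ^ 2"
      unfolding abs_mult power2_eq_square using zw(2) p h by (intro mult_mono) auto
    then have "\<bar>e\<bar> \<le> \<epsilon> / (1024 * real k ^ 2) * (16 * real k ^ 2 * Q)"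
      unfolding e_def abs_mult using zQ h2 \<epsilon> by (intro mult_mono) auto
    also have "\<dots> = \<epsilon> / 64 * Q" using k by (simp add: field_simps)
    finally have e: "\<bar>e\<bar> \<le> \<epsilon> / 64 * Q" .
    have w: "- (\<epsilon> / 16) \<le> w p" "w p \<le> \<epsilon> / 16" "- (\<epsilon> / 16) \<le> w p'" "w p' \<le> \<epsilon> / 16"
      using zw(2)[OF p(1)] zw(2)[OF p(2)] h by auto
    have \<epsilon>\<epsilon>: "0 \<le> \<epsilon> * \<epsilon>" "\<epsilon> * \<epsilon> \<le> \<epsilon>" using \<epsilon> by (auto simp: mult_le_cancel_left1)
    have "1 - \<epsilon> / 4 \<le> (1 - \<epsilon> / 16) * (1 - \<epsilon> / 16)"
      using \<epsilon>(1) \<epsilon>\<epsilon>(1) by (simp add: algebra_simps)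
    also have "\<dots> \<le> t"
      unfolding t_def using w \<epsilon> by (intro mult_mono; simp)
    finally have t_ge: "1 - \<epsilon> / 4 \<le> t" .
    have "t \<le> (1 + \<epsilon> / 16) * (1 + \<epsilon> / 16)"
      unfolding t_def using w \<epsilon> by (intro mult_mono; simp)
    also have "\<dots> \<le> 1 + 3 * \<epsilon> / 8"
      using \<epsilon>(1) \<epsilon>\<epsilon>(2) by (simp add: algebra_simps)
    finally have "t \<le> 1 + 3 * \<epsilon> / 8" .
    with annulus_ratio_bounds[OF \<epsilon> _ _ e t_ge] show ?thesis
      unfolding d dG by (simp add: X_def Q_def)
  qed
  define \<alpha> where "\<alpha> = sqrt (1 - \<epsilon> / 3)"
  have \<alpha>: "0 < \<alpha>" "\<alpha> ^ 2 = 1 - \<epsilon> / 3" using \<epsilon> by (simp_all add: \<alpha>_def)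
  have "\<alpha> * dist p p' \<le> dist (G p) (G p') \<and> dist (G p) (G p') \<le> (1 + \<epsilon>) * \<alpha> * dist p p'"
    if "p \<in> S" "p' \<in> S" for p p'
  proof
    show "\<alpha> * dist p p' \<le> dist (G p) (G p')"
      using bounds[OF that] by - (rule power2_le_imp_le; simp add: power_mult_distrib \<alpha>)
    show "dist (G p) (G p') \<le> (1 + \<epsilon>) * \<alpha> * dist p p'"
      using bounds[OF that] less_imp_le[OF \<alpha>(1)] \<epsilon> by - (rule power2_le_imp_le; simp add: power_mult_distrib \<alpha>)
  qed
  with \<alpha>(1) show ?thesis by blast
qed

section \<open>A net of the Moebius ladder in the band\<close>

text \<open>
  Vertex \<open>a\<close> lies on the boundary at \<open>z = cis (a \<pi> / 3)\<close>, \<open>w = h\<close>. The edge from \<open>0\<close> to \<open>5\<close>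
  starts at angle \<open>2\<pi>\<close> and runs backwards; an edge from \<open>a\<close> to \<open>a + 3\<close> is a rung, on which
  only \<open>w\<close> varies.
\<close>

definition ladder_path :: "real \<Rightarrow> nat \<Rightarrow> nat \<times> nat \<Rightarrow> nat \<Rightarrow> complex \<times> complex" where
  "ladder_path h m e i = (case e of (a, b) \<Rightarrow>
     if b = a + 3 then band_point (cis (pi / 3 * real a)) (h * (1 - 2 * (real i / real m)))
     else band_point (cis (pi / 3 * (if b = a + 1 then real a + real i / real m else 6 - real i / real m))) h)"

lemma ladder_path_ends:
  assumes "(a, b) \<in> ladder_edges" "0 < m"
  shows "ladder_path h m (a, b) 0 = band_point (cis (pi / 3 * real a)) h"
    and "ladder_path h m (a, b) m = band_point (cis (pi / 3 * real b)) h"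
proof -
  have 2: "cis (pi / 3 * 6) = 1" by (simp add: mult.commute flip: cis_2pi)
  show "ladder_path h m (a, b) 0 = band_point (cis (pi / 3 * real a)) h"
    using assms 2 by (auto simp: ladder_path_def ladder_edges_def)
  \<comment> \<open>Half a turn flips the width. This twist is what lets the rung from a, which ends
    at width -h, arrive at vertex a + 3.\<close>
  have "band_point (cis (pi / 3 * (x + 3))) h = band_point (cis (pi / 3 * x)) (- h)" for x
  proof -
    have "cis (pi / 3 * (x + 3)) = - cis (pi / 3 * x)"
      by (simp add: distrib_left flip: cis_mult)
    then show ?thesis by (simp add: band_point_def)
  qed
  from this[of "real a"] show "ladder_path h m (a, b) m = band_point (cis (pi / 3 * real b)) h"
    using assms by (auto simp: ladder_path_def ladder_edges_def add.commute)
qed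

lemma ladder_path_in_moebius_band:
  assumes "0 \<le> h" "i \<le> m"
  shows "ladder_path h m e i \<in> moebius_band h"
proof -
  have "\<bar>1 - 2 * (real i / real m)\<bar> \<le> 1"
    using assms(2) by (cases "m = 0") (auto simp: abs_le_iff divide_simps)
  then have "\<bar>h * (1 - 2 * (real i / real m))\<bar> \<le> h"
    using assms(1) mult_left_mono[of _ 1 h] by (fastforce simp: abs_mult)
  then show ?thesis
    using assms(1) unfolding ladder_path_def moebius_band_def
    by (auto split: prod.splits) (force intro: norm_cis)+
qed

section \<open>Chords of the circle, step lengths and separation of disjoint edges\<close>

lemma norm_cis_diff_sq: "norm (cis x - cis y) ^ 2 = 2 - 2 * cos (x - y)"
proof -
  have "(cos x)\<^sup>2 + (sin x)\<^sup>2 = 1" "(cos y)\<^sup>2 + (sin y)\<^sup>2 = 1" by simp_all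
  then show ?thesis
    unfolding cmod_power2 cos_diff minus_complex.sel cis.sel by algebra
qed

lemma norm_cis_diff_le: "norm (cis x - cis y) \<le> \<bar>x - y\<bar>"
proof (rule power2_le_imp_le)
  have "2 - 2 * cos d = (2 * sin (d / 2)) ^ 2" for d :: real
    using cos_double_sin[of "d / 2"] by (simp add: power_mult_distrib)
  from this[of "x - y"] have "2 - 2 * cos (x - y) = (2 * sin ((x - y) / 2)) ^ 2" .
  also have "\<dots> \<le> (x - y) ^ 2"
    using power_mono[OF abs_sin_x_le_abs_x[of "(x - y) / 2"], of 2]
    by (simp add: power_mult_distrib power_divide)
  finally show "norm (cis x - cis y) ^ 2 \<le> \<bar>x - y\<bar> ^ 2"
    by (simp add: norm_cis_diff_sq)
qed simp

text \<open>A boundary step turns z by pi / (3m); the first coordinate moves at speed 2, the second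
  at speed h \<le> 1, so the step has length at most pi / m. A rung step has length 2h / m.\<close>

lemma ladder_path_step:
  assumes "0 \<le> h" "h \<le> 1" "0 < m"
  shows "dist (ladder_path h m e i) (ladder_path h m e (Suc i)) \<le> 4 / real m"
proof -
  obtain a b where e: "e = (a, b)" by (cases e)
  have strand: "dist (band_point (cis x) h) (band_point (cis y) h) \<le> 4 / real m"
    if "\<bar>x - y\<bar> = pi / (3 * real m)" for x y
  proof -
    have "\<bar>2 * x - 2 * y\<bar> = 2 * \<bar>x - y\<bar>" by (simp add: abs_if)
    then have cis2: "norm (cis (2 * x) - cis (2 * y)) \<le> 2 * \<bar>x - y\<bar>"
      using norm_cis_diff_le[of "2 * x" "2 * y"] by simp
    have "dist (band_point (cis x) h) (band_point (cis y) h)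
        \<le> norm (cis (2 * x) - cis (2 * y)) + norm (of_real h * (cis x - cis y))"
      unfolding band_point_def dist_prod_def fst_conv snd_conv
      by (rule order_trans[OF sqrt_sum_squares_le_sum])
        (simp_all add: dist_norm Complex.DeMoivre algebra_simps)
    also have "\<dots> \<le> 2 * \<bar>x - y\<bar> + 1 * \<bar>x - y\<bar>"
      using cis2 assms
      unfolding norm_mult by (intro add_mono mult_mono norm_cis_diff_le) auto
    also have "\<dots> \<le> 4 / real m" using that pi_less_4 assms by (simp add: divide_simps)
    finally show ?thesis .
  qed
  have rung: "dist (band_point (cis x) (h * (1 - 2 * (real i / real m))))
      (band_point (cis x) (h * (1 - 2 * (real (Suc i) / real m)))) \<le> 4 / real m" for x
  proof -
    have "(h * (1 - 2 * (real i / real m)) - h * (1 - 2 * (real (Suc i) / real m))) = 2 * h / real m"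
      using assms by (simp add: field_simps)
    then have "dist (band_point (cis x) (h * (1 - 2 * (real i / real m))))
      (band_point (cis x) (h * (1 - 2 * (real (Suc i) / real m)))) ^ 2 = (2 * h / real m) ^ 2"
      by (subst dist_band_point_sq) simp_all
    also have "\<dots> \<le> (4 / real m) ^ 2" using assms by (intro power_mono divide_right_mono) auto
    finally show ?thesis by (rule power2_le_imp_le) simp
  qed
  have diff: "\<bar>pi / 3 * x - pi / 3 * y\<bar> = pi / (3 * real m)" if "\<bar>x - y\<bar> = 1 / real m" for x y
  proof -
    have "\<bar>pi / 3 * x - pi / 3 * y\<bar> = \<bar>pi / 3\<bar> * \<bar>x - y\<bar>"
      by (simp only: abs_mult right_diff_distrib[symmetric])
    then show ?thesis using that by simp
  qed
  consider "b = a + 3" | "b \<noteq> a + 3" "b = a + 1" | "b \<noteq> a + 3" "b \<noteq> a + 1" by blast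
  then show ?thesis
  proof cases
    case 1
    show ?thesis unfolding e ladder_path_def prod.case if_P[OF 1] by (rule rung)
  next
    case 2
    show ?thesis unfolding e ladder_path_def prod.case if_not_P[OF 2(1)] if_P[OF 2(2)]
      by (intro strand diff) (simp add: add_divide_distrib)
  next
    case 3
    show ?thesis unfolding e ladder_path_def prod.case if_not_P[OF 3(1)] if_not_P[OF 3(2)]
      by (intro strand diff) (simp add: add_divide_distrib)
  qed
qed

text \<open>With \<open>norm_cis_diff_sq\<close> this says that directions at least 60 degrees apart
  have a chord of length at least 1.\<close>

lemma cos_le_half:
  assumes "pi / 3 \<le> \<bar>x\<bar>" "\<bar>x\<bar> \<le> 5 * pi / 3"
  shows "cos x \<le> 1 / 2"
proof -
  have "cos \<bar>x\<bar> \<le> cos (pi / 3)"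
  proof (cases "\<bar>x\<bar> \<le> pi")
    case True
    then show ?thesis using assms by (intro cos_monotone_0_pi_le) auto
  next
    case False
    have "cos (2 * pi - \<bar>x\<bar>) \<le> cos (pi / 3)"
      using assms False by (intro cos_monotone_0_pi_le) auto
    then show ?thesis by (simp add: cos_diff)
  qed
  then show ?thesis by (simp add: cos_60)
qed

text \<open>Positions are measured in units of pi / 3, so a full turn is 6. Disjoint boundary edges
  are at least 1 apart modulo 6, and their second coordinates h * z differ by at least h; opposite
  ones may agree in z^2. A rung meets both sides of the band, but z^2 is constant on it and
  separates it from any disjoint edge: twice the position difference stays at least 1 away from
  multiples of 6.\<close>

lemma ladder_path_separation:
  assumes e: "e \<in> ladder_edges" "e' \<in> ladder_edges" "disjoint_edges e e'"
    and h: "0 \<le> h" "h \<le> 1" and ij: "i \<le> m" "j \<le> m" "0 < m"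
  shows "h \<le> dist (ladder_path h m e i) (ladder_path h m e' j)"
proof -
  define s t where "s = real i / real m" and "t = real j / real m"
  have st: "0 \<le> s" "s \<le> 1" "0 \<le> t" "t \<le> 1" using ij by (simp_all add: s_def t_def)
  have strands: "h \<le> dist (band_point (cis (pi / 3 * x)) h) (band_point (cis (pi / 3 * y)) h)"
    if "1 \<le> \<bar>x - y\<bar>" "\<bar>x - y\<bar> \<le> 5" for x y
  proof (rule power2_le_imp_le)
    have "cos (pi / 3 * (x - y)) \<le> 1 / 2"
      using that by (intro cos_le_half) (auto simp: abs_mult)
    then have "1 \<le> norm (cis (pi / 3 * x) - cis (pi / 3 * y)) ^ 2"
      by (simp add: norm_cis_diff_sq right_diff_distrib)
    then have "h ^ 2 * 1 \<le> h ^ 2 * norm (cis (pi / 3 * x) - cis (pi / 3 * y)) ^ 2"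
      by (intro mult_left_mono) auto
    then show "h ^ 2 \<le> dist (band_point (cis (pi / 3 * x)) h) (band_point (cis (pi / 3 * y)) h) ^ 2"
      unfolding dist_band_point_sq[OF norm_cis norm_cis] by (simp add: power2_eq_square add_increasing)
  qed simp
  have rung: "h \<le> dist (band_point (cis (pi / 3 * x)) w) (band_point (cis (pi / 3 * y)) v)"
    if "(1 \<le> 2 * \<bar>x - y\<bar> \<and> 2 * \<bar>x - y\<bar> \<le> 5) \<or> (7 \<le> 2 * \<bar>x - y\<bar> \<and> 2 * \<bar>x - y\<bar> \<le> 11)" for x y w v
  proof -
    have "cos (pi / 3 * (2 * \<bar>x - y\<bar>)) \<le> 1 / 2"
      using that
    proof
      assume "1 \<le> 2 * \<bar>x - y\<bar> \<and> 2 * \<bar>x - y\<bar> \<le> 5"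
      then show ?thesis by (intro cos_le_half) (auto simp: abs_mult)
    next
      assume *: "7 \<le> 2 * \<bar>x - y\<bar> \<and> 2 * \<bar>x - y\<bar> \<le> 11"
      have "cos (pi / 3 * (2 * \<bar>x - y\<bar>)) = cos (pi / 3 * (2 * \<bar>x - y\<bar> - 6))"
        using cos_diff[of "pi / 3 * (2 * \<bar>x - y\<bar>)" "2 * pi"] by (simp add: right_diff_distrib mult_ac)
      also have "\<dots> \<le> 1 / 2" using * by (intro cos_le_half) (auto simp: abs_mult)
      finally show ?thesis .
    qed
    moreover have "cos (pi / 3 * (2 * \<bar>x - y\<bar>)) = cos (2 * (pi / 3 * x) - 2 * (pi / 3 * y))"
    proof (cases "y \<le> x")
      case True
      then have "pi / 3 * (2 * \<bar>x - y\<bar>) = 2 * (pi / 3 * x) - 2 * (pi / 3 * y)"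
        by (simp add: field_simps)
      then show ?thesis by (simp only:)
    next
      case False
      then have "pi / 3 * (2 * \<bar>x - y\<bar>) = - (2 * (pi / 3 * x) - 2 * (pi / 3 * y))"
        by (simp add: field_simps)
      then show ?thesis by (simp only: cos_minus)
    qed
    ultimately have "1 \<le> norm (cis (2 * (pi / 3 * x)) - cis (2 * (pi / 3 * y))) ^ 2"
      by (simp add: norm_cis_diff_sq)
    then have "1 ^ 2 \<le> norm (cis (2 * (pi / 3 * x)) - cis (2 * (pi / 3 * y))) ^ 2" by simp
    then have "1 \<le> norm (cis (2 * (pi / 3 * x)) - cis (2 * (pi / 3 * y)))"
      by (rule power2_le_imp_le) simp
    also have "\<dots> \<le> dist (band_point (cis (pi / 3 * x)) w) (band_point (cis (pi / 3 * y)) v)"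
      unfolding band_point_def using dist_fst_le by (metis Complex.DeMoivre dist_norm fst_conv of_nat_numeral)
    finally show ?thesis using h by simp
  qed
  obtain a b c d where ab: "e = (a, b)" and cd: "e' = (c, d)" by (cases e, cases e')
  define pos where "pos = (\<lambda>(a :: nat) b u.
    if b = a + 3 then real a else if b = a + 1 then real a + u else 6 - u)"
  have path: "ladder_path h m (a, b) i = band_point (cis (pi / 3 * pos a b (real i / real m)))
      (if b = a + 3 then h * (1 - 2 * (real i / real m)) else h)" for a b i
    by (simp add: ladder_path_def pos_def)
  show ?thesis
  proof (cases "b = a + 3 \<or> d = c + 3")
    case True
    have "(1 \<le> 2 * \<bar>pos a b s - pos c d t\<bar> \<and> 2 * \<bar>pos a b s - pos c d t\<bar> \<le> 5) \<or>
        (7 \<le> 2 * \<bar>pos a b s - pos c d t\<bar> \<and> 2 * \<bar>pos a b s - pos c d t\<bar> \<le> 11)"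
      using e st True unfolding ladder_edges_def disjoint_edges_def ab cd
      by (elim insertE emptyE) (simp_all add: pos_def)
    then show ?thesis unfolding ab cd path s_def t_def by (rule rung)
  next
    case False
    have "1 \<le> \<bar>pos a b s - pos c d t\<bar> \<and> \<bar>pos a b s - pos c d t\<bar> \<le> 5"
      using e st False unfolding ladder_edges_def disjoint_edges_def ab cd
      by (elim insertE emptyE) (simp_all add: pos_def)
    then show ?thesis using False strands by (simp add: ab cd path s_def t_def)
  qed
qed

definition ladder_net :: "real \<Rightarrow> nat \<Rightarrow> (complex \<times> complex) set" where
  "ladder_net h m = (\<lambda>(e, i). ladder_path h m e i) ` (ladder_edges \<times> {..m})"

lemma ladder_net_card: "finite (ladder_net h m)" "card (ladder_net h m) \<le> 9 * (m + 1)"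
proof -
  have fin: "finite (ladder_edges \<times> {..m})" by (simp add: ladder_edges_def)
  then show "finite (ladder_net h m)" by (simp add: ladder_net_def)
  have "card (ladder_net h m) \<le> card (ladder_edges \<times> {..m})"
    unfolding ladder_net_def by (rule card_image_le[OF fin])
  also have "\<dots> = 9 * (m + 1)" by (simp add: card_cartesian_product ladder_edges_def)
  finally show "card (ladder_net h m) \<le> 9 * (m + 1)" .
qed

text \<open>Apply \<open>disjoint_ladder_edges_meet\<close> to the image of the net: some step, of
  length at most 4 / m before mapping, has an image at least as long as the image of a distance of
  at least h.\<close>

lemma ladder_net_planar_distortion:
  fixes F :: "complex \<times> complex \<Rightarrow> complex"
  assumes h: "0 \<le> h" "h \<le> 1" and "0 < m" "0 < \<alpha>" "0 \<le> D"
    and lower: "\<And>p p'. p \<in> ladder_net h m \<Longrightarrow> p' \<in> ladder_net h m \<Longrightarrow> \<alpha> * dist p p' \<le> dist (F p) (F p')"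
    and upper: "\<And>p p'. p \<in> ladder_net h m \<Longrightarrow> p' \<in> ladder_net h m \<Longrightarrow> dist (F p) (F p') \<le> D * \<alpha> * dist p p'"
  shows "h * real m / 4 \<le> D"
proof -
  have net: "ladder_path h m e i \<in> ladder_net h m" if "e \<in> ladder_edges" "i \<le> m" for e i
    using that unfolding ladder_net_def by force
  obtain e e' i j where e: "e \<in> ladder_edges" "e' \<in> ladder_edges" "disjoint_edges e e'"
    and ij: "i < m" "j \<le> m"
    and close: "norm (F (ladder_path h m e i) - F (ladder_path h m e' j))
      \<le> norm (F (ladder_path h m e (Suc i)) - F (ladder_path h m e i))"
    using disjoint_ladder_edges_meet[of m "\<lambda>e i. F (ladder_path h m e i)"
        "\<lambda>a. F (band_point (cis (pi / 3 * real a)) h)"] ladder_path_ends \<open>0 < m\<close>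
    by metis
  have "\<alpha> * h \<le> \<alpha> * dist (ladder_path h m e i) (ladder_path h m e' j)"
    using ladder_path_separation[OF e h] ij \<open>0 < \<alpha>\<close> by (intro mult_left_mono) auto
  also have "\<dots> \<le> dist (F (ladder_path h m e i)) (F (ladder_path h m e' j))"
    using e ij by (intro lower net) auto
  also have "\<dots> \<le> dist (F (ladder_path h m e i)) (F (ladder_path h m e (Suc i)))"
    using close by (simp add: dist_norm norm_minus_commute)
  also have "\<dots> \<le> D * \<alpha> * dist (ladder_path h m e i) (ladder_path h m e (Suc i))"
    using e ij by (intro upper net) auto
  also have "\<dots> \<le> D * \<alpha> * (4 / real m)"
    using ladder_path_step[OF h \<open>0 < m\<close>] \<open>0 < \<alpha>\<close> \<open>0 \<le> D\<close> by (intro mult_left_mono) auto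
  finally have "\<alpha> * h \<le> \<alpha> * (4 * D / real m)" by (simp add: mult_ac)
  then have "h \<le> 4 * D / real m" using \<open>0 < \<alpha>\<close> by (simp only: mult_le_cancel_left_pos)
  then show ?thesis using \<open>0 < m\<close> by (simp add: field_simps)
qed

section \<open>Extending the net to a prescribed number of points\<close>

lemma infinite_moebius_band:
  assumes "0 < h"
  shows "infinite (moebius_band h)"
proof -
  have "band_point 1 ` {0..h} \<subseteq> moebius_band h"
    unfolding moebius_band_def by force
  moreover have "inj_on (band_point 1) {0..h}"
    by (auto simp: inj_on_def band_point_def)
  then have "infinite (band_point 1 ` {0..h})"
    using assms by (simp add: finite_image_iff infinite_Icc)
  ultimately show ?thesis using finite_subset by blast
qed

lemma exists_finite_superset_card:
  assumes "finite B" "card B \<le> n" "infinite A" "B \<subseteq> A"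
  shows "\<exists>C. B \<subseteq> C \<and> C \<subseteq> A \<and> finite C \<and> card C = n"
proof -
  obtain C where C: "finite C" "card C = n - card B" "C \<subseteq> A - B"
    using infinite_arbitrarily_large[of "A - B"] assms(1,3) by (meson Diff_infinite_finite)
  moreover have "card (B \<union> C) = n"
    using C assms by (subst card_Un_disjoint) auto
  ultimately show ?thesis using assms by (intro exI[of _ "B \<union> C"]) auto
qed

section \<open>Transfer to abstract metrics and maps into \<open>real ^ 2\<close>\<close>

definition vec_of_complex :: "complex \<Rightarrow> real ^ 2" where
  "vec_of_complex z = vector [Re z, Im z]"

definition complex_of_vec :: "real ^ 2 \<Rightarrow> complex" where
  "complex_of_vec v = Complex (v $ 1) (v $ 2)"

lemma dist_vec_of_complex: "dist (vec_of_complex x) (vec_of_complex y) = dist x y"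
  by (simp add: dist_norm norm_vec_def L2_set_def sum_2 vec_of_complex_def cmod_def)

lemma dist_complex_of_vec: "dist (complex_of_vec x) (complex_of_vec y) = dist x y"
  by (simp add: dist_norm norm_vec_def L2_set_def sum_2 complex_of_vec_def cmod_def)

text \<open>The map \<open>p\<close> places the abstract points isometrically in the ambient space,
  so \<open>f\<close> composed with an inverse of \<open>p\<close> is a planar map on the
  net.\<close>

lemma distortion_ge_if_ladder_net:
  fixes X :: "'a metric" and f :: "'a \<Rightarrow> real ^ 2"
  assumes "finite (mspace X)" "metric_embedding X euclidean_metric f"
    and p: "inj_on p (mspace X)" "\<And>x y. x \<in> mspace X \<Longrightarrow> y \<in> mspace X \<Longrightarrow> mdist X x y = dist (p x) (p y)"
    and net: "ladder_net h m \<subseteq> p ` mspace X" and h: "0 \<le> h" "h \<le> 1" and "0 < m"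
  shows "h * real m / 4 \<le> distortion X euclidean_metric f"
proof -
  define D where "D = distortion X euclidean_metric f"
  have "distortion_le X euclidean_metric f D"
    unfolding D_def by (rule distortion_le_distortion[OF assms(1,2)])
  then obtain \<alpha> where D: "1 \<le> D" "0 < \<alpha>"
    and f: "\<And>x y. x \<in> mspace X \<Longrightarrow> y \<in> mspace X \<Longrightarrow>
      \<alpha> * mdist X x y \<le> dist (f x) (f y) \<and> dist (f x) (f y) \<le> D * \<alpha> * mdist X x y"
    unfolding distortion_le_def by auto
  define q where "q = the_inv_into (mspace X) p"
  have q: "q u \<in> mspace X" "p (q u) = u" if "u \<in> ladder_net h m" for u
    using that net p(1) unfolding q_def by (auto intro: the_inv_into_into f_the_inv_into_f)
  have "h * real m / 4 \<le> D"
    by (rule ladder_net_planar_distortion[where F = "\<lambda>u. complex_of_vec (f (q u))" and \<alpha> = \<alpha>])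
      (use D f q p(2) h \<open>0 < m\<close> in \<open>simp_all add: dist_complex_of_vec, metis+\<close>)
  then show ?thesis by (simp add: D_def)
qed

lemma planar_embedding_if_bilipschitz:
  fixes X :: "'a metric" and G :: "complex \<times> complex \<Rightarrow> complex"
  assumes "finite (mspace X)" "0 < \<alpha>" "1 \<le> D"
    and p: "inj_on p (mspace X)" "\<And>x y. x \<in> mspace X \<Longrightarrow> y \<in> mspace X \<Longrightarrow> mdist X x y = dist (p x) (p y)"
    and G: "\<And>u v. u \<in> p ` mspace X \<Longrightarrow> v \<in> p ` mspace X \<Longrightarrow>
      \<alpha> * dist u v \<le> dist (G u) (G v) \<and> dist (G u) (G v) \<le> D * \<alpha> * dist u v"
  defines "g \<equiv> \<lambda>x. vec_of_complex (G (p x))"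
  shows "metric_embedding X euclidean_metric g" "distortion X euclidean_metric g \<le> D"
proof -
  have dist: "\<alpha> * mdist X x y \<le> dist (g x) (g y) \<and> dist (g x) (g y) \<le> D * \<alpha> * mdist X x y"
    if "x \<in> mspace X" "y \<in> mspace X" for x y
    using G[of "p x" "p y"] that by (simp add: g_def dist_vec_of_complex p(2))
  have "inj_on g (mspace X)"
  proof (rule inj_onI)
    fix x y assume xy: "x \<in> mspace X" "y \<in> mspace X" "g x = g y"
    then have "\<alpha> * dist (p x) (p y) \<le> 0" using dist[of x y] by (simp add: p(2))
    then have "p x = p y" using \<open>0 < \<alpha>\<close> by (simp add: mult_le_0_iff)
    then show "x = y" using p(1) xy by (simp add: inj_on_def)
  qed
  then show emb: "metric_embedding X euclidean_metric g"
    by (simp add: metric_embedding_def)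
  show "distortion X euclidean_metric g \<le> D"
    using dist \<open>0 < \<alpha>\<close> \<open>1 \<le> D\<close>
    by (intro distortion_least[OF assms(1) emb]) (auto simp: distortion_le_def)
qed

section \<open>Choice of the parameters\<close>

theorem theorem1p3:
  shows "\<exists>c>0. \<exists>c'>0. \<forall>\<epsilon>::real. 0 < \<epsilon> \<and> \<epsilon> < 1 \<longrightarrow>
    (\<exists>N::nat. \<forall>n\<ge>N. \<forall>k::nat.
      1 / sqrt \<epsilon> \<le> real k \<and> real k \<le> c * sqrt \<epsilon> * real n \<longrightarrow>
      (\<exists>X :: nat metric. finite (mspace X) \<and> card (mspace X) = n \<and>
        (\<forall>f :: nat \<Rightarrow> real^2. metric_embedding X euclidean_metric f \<longrightarrow>
           distortion X euclidean_metric f \<ge> c' * sqrt \<epsilon> * real n / real k) \<and>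
        (\<forall>S\<subseteq>mspace X. card S = k \<longrightarrow>
           (\<exists>g :: nat \<Rightarrow> real^2. metric_embedding (submetric X S) euclidean_metric g \<and>
              distortion (submetric X S) euclidean_metric g \<le> 1 + \<epsilon>))))"
proof (rule exI[of _ 1], intro conjI zero_less_one, rule exI[of _ "1 / 2304"], intro conjI allI impI)
  fix \<epsilon> :: real
  assume "0 < \<epsilon> \<and> \<epsilon> < 1"
  then have \<epsilon>: "0 < \<epsilon>" "\<epsilon> < 1" by auto
  show "\<exists>N::nat. \<forall>n\<ge>N. \<forall>k::nat.
      1 / sqrt \<epsilon> \<le> real k \<and> real k \<le> 1 * sqrt \<epsilon> * real n \<longrightarrow>
      (\<exists>X :: nat metric. finite (mspace X) \<and> card (mspace X) = n \<and>
        (\<forall>f :: nat \<Rightarrow> real^2. metric_embedding X euclidean_metric f \<longrightarrow>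
           distortion X euclidean_metric f \<ge> 1 / 2304 * sqrt \<epsilon> * real n / real k) \<and>
        (\<forall>S\<subseteq>mspace X. card S = k \<longrightarrow>
           (\<exists>g :: nat \<Rightarrow> real^2. metric_embedding (submetric X S) euclidean_metric g \<and>
              distortion (submetric X S) euclidean_metric g \<le> 1 + \<epsilon>)))"
  proof (rule exI[of _ 36], intro allI impI)
    fix n k :: nat
    assume n: "36 \<le> n" and "1 / sqrt \<epsilon> \<le> real k \<and> real k \<le> 1 * sqrt \<epsilon> * real n"
    then have k_ge: "1 \<le> sqrt \<epsilon> * real k" using \<epsilon> by (simp add: divide_le_eq mult.commute)
    then have k: "0 < k" using gr0I by fastforce
    \<comment> \<open>The largest width for which the mixed term is controlled; the lower bound on k
      turns it into h \<le> \<epsilon> / 32, which also controls the radii.\<close>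
    define h where "h = sqrt \<epsilon> / (32 * real k)"
    have h0: "0 < h" using \<epsilon> k by (simp add: h_def)
    have "sqrt \<epsilon> * 1 \<le> sqrt \<epsilon> * (sqrt \<epsilon> * real k)"
      using k_ge \<epsilon> by (intro mult_left_mono) auto
    then have "sqrt \<epsilon> \<le> \<epsilon> * real k" using \<epsilon> by (simp flip: mult.assoc)
    then have h: "h \<le> \<epsilon> / 32" using k by (simp add: h_def field_simps)
    \<comment> \<open>Nine edges with m + 1 points each must fit into n points. Since n \<ge> 36
      gives m \<ge> 3, the rounding n \<le> 9m + 17 still yields n \<le> 18m.\<close>
    define m where "m = n div 9 - 1"
    have "n div 9 = m + 1" using n by (simp add: m_def)
    then obtain r where "n = 9 * (m + 1) + r" "r < 9"
      by (metis mult_div_mod_eq mod_less_divisor zero_less_numeral)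
    then have m: "9 * (m + 1) \<le> n" "n \<le> 18 * m" "0 < m" using n by simp_all
    have net_band: "ladder_net h m \<subseteq> moebius_band h"
      using ladder_path_in_moebius_band h0 by (auto simp: ladder_net_def)
    obtain A where A: "ladder_net h m \<subseteq> A" "A \<subseteq> moebius_band h" "finite A" "card A = n"
      using exists_finite_superset_card[OF ladder_net_card(1) _ infinite_moebius_band[OF h0] net_band]
        ladder_net_card(2)[of h m] m(1) by (meson le_trans)
    obtain p where p: "bij_betw p {..<n} A"
      using ex_bij_betw_nat_finite[OF A(3)] A(4) by (auto simp: lessThan_atLeast0)
    have inj: "inj_on p {..<n}" and img: "p ` {..<n} = A" using p by (auto simp: bij_betw_def)
    interpret M: Metric_space "{..<n}" "\<lambda>i j. dist (p i) (p j)"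
      by standard (use inj in \<open>auto simp: dist_commute inj_on_eq_iff dist_triangle\<close>)
    define X where "X = metric ({..<n}, \<lambda>i j. dist (p i) (p j))"
    have X: "mspace X = {..<n}" "mdist X = (\<lambda>i j. dist (p i) (p j))" by (simp_all add: X_def)
    have "1 / 2304 * sqrt \<epsilon> * real n / real k \<le> distortion X euclidean_metric f"
      if "metric_embedding X euclidean_metric f" for f :: "nat \<Rightarrow> real ^ 2"
    proof -
      \<comment> \<open>2304 = 32 * 18 * 4: from the width h, from m \<ge> n / 18, and from the
        lower bound h * m / 4 on the distortion.\<close>
      have "1 / 2304 * sqrt \<epsilon> * real n / real k = h * (real n / 18) / 4" by (simp add: h_def)
      also have "\<dots> \<le> h * real m / 4"
        using m(2) h0 by (intro divide_right_mono mult_left_mono) auto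
      also have "\<dots> \<le> distortion X euclidean_metric f"
        by (rule distortion_ge_if_ladder_net[where p = p])
          (use that inj img A(1) h0 h \<epsilon> m(3) in \<open>simp_all add: X\<close>)
      finally show ?thesis .
    qed
    moreover have "\<exists>g :: nat \<Rightarrow> real^2. metric_embedding (submetric X S) euclidean_metric g \<and>
        distortion (submetric X S) euclidean_metric g \<le> 1 + \<epsilon>"
      if S: "S \<subseteq> mspace X" "card S = k" for S
    proof -
      have Sn: "S \<subseteq> {..<n}" "finite S" using S k by (auto simp: X intro: card_ge_0_finite)
      have "p ` S \<subseteq> moebius_band h" using Sn(1) A(2) img by blast
      then obtain G \<alpha> where "0 < \<alpha>" and G: "\<And>u v. u \<in> p ` S \<Longrightarrow> v \<in> p ` S \<Longrightarrow>
          \<alpha> * dist u v \<le> dist (G u :: complex) (G v) \<and> dist (G u) (G v) \<le> (1 + \<epsilon>) * \<alpha> * dist u v"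
        using moebius_band_finite_subset_planar[of "p ` S" h k \<epsilon>] card_image_le[OF Sn(2), of p]
          S(2) k \<epsilon> h h0 Sn(2) h_def by force
      have ms: "mspace (submetric X S) = S" using Sn by (auto simp: X)
      have md: "mdist (submetric X S) = (\<lambda>i j. dist (p i) (p j))" by (simp add: X)
      show ?thesis
        using planar_embedding_if_bilipschitz[of "submetric X S" \<alpha> "1 + \<epsilon>" p G, unfolded ms md,
            OF Sn(2) \<open>0 < \<alpha>\<close> _ inj_on_subset[OF inj Sn(1)] refl G] \<epsilon>
        by (intro exI conjI) auto
    qed
    ultimately show "\<exists>X :: nat metric. finite (mspace X) \<and> card (mspace X) = n \<and>
        (\<forall>f :: nat \<Rightarrow> real^2. metric_embedding X euclidean_metric f \<longrightarrow>
           distortion X euclidean_metric f \<ge> 1 / 2304 * sqrt \<epsilon> * real n / real k) \<and>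
        (\<forall>S\<subseteq>mspace X. card S = k \<longrightarrow>
           (\<exists>g :: nat \<Rightarrow> real^2. metric_embedding (submetric X S) euclidean_metric g \<and>
              distortion (submetric X S) euclidean_metric g \<le> 1 + \<epsilon>))"
      by (intro exI[of _ X]) (simp add: X)
  qed
qed simp

end
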